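(* Let $K_1$ and $K_2$ be two complete graphs on $n_1\ge 1$ and $n_2\ge 1$ vertices, respectively. Let $G$ be a bridge sum of $K_1$ and $K_2$ (at any vertex of $K_1$ and any vertex of $K_2$). Then all orbits of toric promotion on $G$ have length $(n_1+n_2)(n_1+n_2-1)$.
   Context: Toric promotion. Let $G=(V,E)$ be a finite simple graph (undirected, no loops, no multiple edges) on $N$ vertices. A labeling of $G$ is a bijection $\sigma:V\to\mathbb{Z}/N\mathbb{Z}=\{1,\dots,N\}$ (addition modulo $N$). A state is a pair $(\sigma,i)$ with $\sigma$ a labeling of $G$ and $i\in\mathbb{Z}/N\mathbb{Z}$; $\Omega_G$ is the set of all states. Toric promotion is the map $\mathrm{TPro}:\Omega_G\to\Omega_G$ given by $\mathrm{TPro}(\sigma,i)=(\sigma,i+1)$ if $\{\sigma^{-1}(i),\sigma^{-1}(i+1)\}\in E$, and $\mathrm{TPro}(\sigma,i)=((i,i+1)\circ\sigma,\,i+1)$ otherwise, where $(i,i+1)$ is the permutation of $\mathbb{Z}/N\mathbb{Z}$ swapping $i$ and $i+1$. It is a bijection of $\Omega_G$. The length of the orbit containing $(\sigma,i)$ is the least $L\ge 1$ with $\mathrm{TPro}^L(\sigma,i)=(\sigma,i)$. Bridge sum. For graphs $G_1=(V_1,E_1)$, $G_2=(V_2,E_2)$ with disjoint vertex sets and vertices $v_1\in V_1$, $v_2\in V_2$, the bridge sum of $G_1$ and $G_2$ at $v_1$ and $v_2$ is the graph with vertex set $V_1\cup V_2$ and edge set $E_1\cup E_2\cup\{\{v_1,v_2\}\}$.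 *)

theory Defs
  imports
    "HOL-Library.FuncSet"
    "HOL-Combinatorics.Transposition"
    "Graph_Theory.Kuratowski"
begin

text \<open>
  A finite simple graph is a \<^locale>\<open>pair_graph\<close>: an undirected edge joining \<open>u\<close> and \<open>v\<close> is
  represented by the two arcs \<open>(u, v)\<close> and \<open>(v, u)\<close>.
\<close>

definition bridge_sum ::
  "'a pair_pre_digraph \<Rightarrow> 'a pair_pre_digraph \<Rightarrow> 'a \<Rightarrow> 'a \<Rightarrow> 'a pair_pre_digraph" where
  "bridge_sum G\<^sub>1 G\<^sub>2 v\<^sub>1 v\<^sub>2 =
     \<lparr> pverts = pverts G\<^sub>1 \<union> pverts G\<^sub>2,
       parcs = parcs G\<^sub>1 \<union> parcs G\<^sub>2 \<union> {(v\<^sub>1, v\<^sub>2), (v\<^sub>2, v\<^sub>1)} \<rparr>"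

text \<open>
  The residues modulo \<open>N\<close> are represented by \<open>{1..N}\<close>, so that the successor of \<open>N\<close> is \<open>1\<close>.
\<close>

definition cyc_suc :: "nat \<Rightarrow> nat \<Rightarrow> nat" where
  "cyc_suc N i = i mod N + 1"

text \<open>
  Labelings are extensional functions, i.e. \<^const>\<open>undefined\<close> off the vertex set, so that
  two of them are equal iff they agree on all vertices.
\<close>

definition labelings :: "'a pair_pre_digraph \<Rightarrow> ('a \<Rightarrow> nat) set" where
  "labelings G =
     {\<sigma> \<in> extensional (pverts G). bij_betw \<sigma> (pverts G) {1..card (pverts G)}}"

definition states :: "'a pair_pre_digraph \<Rightarrow> (('a \<Rightarrow> nat) \<times> nat) set" where
  "states G = labelings G \<times> {1..card (pverts G)}"

text \<open>
  The composition with the transposition is restricted to the vertex set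
  (\<^const>\<open>compose\<close>), so that it is a labeling again.
\<close>

definition TPro :: "'a pair_pre_digraph \<Rightarrow> ('a \<Rightarrow> nat) \<times> nat \<Rightarrow> ('a \<Rightarrow> nat) \<times> nat" where
  "TPro G = (\<lambda>(\<sigma>, i).
     let V = pverts G; j = cyc_suc (card V) i in
     if (inv_into V \<sigma> i, inv_into V \<sigma> j) \<in> parcs G
     then (\<sigma>, j)
     else (compose V (transpose i j) \<sigma>, j))"

definition orbit_length :: "('s \<Rightarrow> 's) \<Rightarrow> 's \<Rightarrow> nat" where
  "orbit_length f x = (LEAST L. L \<ge> 1 \<and> (f ^^ L) x = x)"

end

theory Submission
  imports Defs "HOL-Number_Theory.Cong"
begin

text \<open>
  Read the vertices cyclically in the order of their labels, starting at the label \<open>i\<close>. Toric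
  promotion compares the first two letters: it makes the second one the head if they are adjacent,
  and lets the head jump over the second one otherwise. As long as the head lies in the clique
  \<open>A\<close> (of size \<open>p\<close>), it jumps over the letters of the other clique \<open>B\<close> (of size \<open>q\<close>) that follow
  it and then hands over to the next letter of \<open>A\<close>. In terms of the \<open>p\<close> letters of \<open>A\<close> and the
  \<open>p - 1\<close> gaps between them, both sequences are rotated by one place. Since \<open>p\<close> and \<open>p - 1\<close> are
  coprime, the endpoint \<open>a\<close> of the bridge meets the gap containing the other endpoint \<open>b\<close> exactly
  once in \<open>p (p - 1)\<close> such rotations, and then the head passes to \<open>B\<close>. In this way
  \<open>a M b\<close> becomes \<open>b M a\<close> after \<open>p (p + q - 1)\<close> steps with the head in \<open>A\<close>, and by symmetry
  \<open>a M b\<close> again after \<open>q (p + q - 1)\<close> further steps with the head in \<open>B\<close>. Hence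
  \<open>(p + q) (p + q - 1)\<close> is a period, and it is the least one because the head enters \<open>A\<close> only once
  during it.
\<close>

section \<open>Toric promotion as a map on words\<close>

text \<open>The result is read from the label \<open>i + 1\<close> on, so the letter that then
  carries the label \<open>i\<close> comes last.\<close>

fun advance :: "('a \<Rightarrow> 'a \<Rightarrow> bool) \<Rightarrow> 'a list \<Rightarrow> 'a list" where
  "advance E (x # y # zs) = (if E x y then y # zs @ [x] else x # zs @ [y])"
| "advance E xs = xs"

lemma length_advance [simp]: "length (advance E xs) = length xs"
  by (cases "(E, xs)" rule: advance.cases) auto

lemma mset_advance [simp]: "mset (advance E xs) = mset xs"
  by (cases "(E, xs)" rule: advance.cases) auto

lemma advance_cong:
  assumes "distinct xs"
    and "\<And>x y. x \<in> set xs \<Longrightarrow> y \<in> set xs \<Longrightarrow> x \<noteq> y \<Longrightarrow> E x y \<longleftrightarrow> E' x y"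
  shows "advance E xs = advance E' xs"
  using assms by (cases "(E, xs)" rule: advance.cases) auto

text \<open>The first two letters become the two ends of the image, and by symmetry of
  \<open>E\<close> their adjacency tells which case produced it.\<close>

lemma inj_advance:
  assumes "symp E"
  shows "inj (advance E)"
proof (rule injI)
  fix xs ys :: "'a list"
  assume eq: "advance E xs = advance E ys"
  then have "length xs = length ys"
    by (metis length_advance)
  with eq assms show "xs = ys"
    by (cases "(E, xs)" rule: advance.cases; cases "(E, ys)" rule: advance.cases)
      (auto split: if_splits dest: sympD)
qed

section \<open>Iteration with a condition on the way\<close>

lemma funpow_funpow: "(f ^^ m) ((f ^^ n) x) = (f ^^ (m + n)) x"
  by (simp add: funpow_add)

definition runs :: "('s \<Rightarrow> 's) \<Rightarrow> ('s \<Rightarrow> bool) \<Rightarrow> nat \<Rightarrow> 's \<Rightarrow> 's \<Rightarrow> bool" where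
  "runs f P k x y \<longleftrightarrow> (f ^^ k) x = y \<and> (\<forall>j<k. P ((f ^^ j) x))"

lemma runs_mono: "runs f P k x y \<Longrightarrow> (\<And>z. P z \<Longrightarrow> Q z) \<Longrightarrow> runs f Q k x y"
  by (auto simp: runs_def)

lemma runs_0 [simp]: "runs f P 0 x y \<longleftrightarrow> x = y"
  by (simp add: runs_def)

lemma runs_1: "P x \<Longrightarrow> f x = y \<Longrightarrow> runs f P 1 x y"
  by (simp add: runs_def)

lemma runs_funpow: "runs f P k x y \<Longrightarrow> (f ^^ k) x = y"
  by (simp add: runs_def)

lemma runs_trans:
  assumes "runs f P k x y" and "runs f P l y z"
  shows "runs f P (k + l) x z"
proof -
  have shift: "(f ^^ (k + m)) x = (f ^^ m) y" for m
    using assms(1) by (simp add: runs_def add.commute[of k m] funpow_add)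
  have "P ((f ^^ j) x)" if "j < k + l" for j
  proof (cases "j < k")
    case False
    then show ?thesis
      using assms(2) that shift[of "j - k"] by (simp add: runs_def)
  qed (use assms(1) in \<open>simp add: runs_def\<close>)
  then show ?thesis
    using assms(2) shift[of l] by (simp add: runs_def)
qed

text \<open>A period \<open>l < T = p + q\<close> would make \<open>P\<close> false at time \<open>l - 1\<close> (as it is at time \<open>T - 1\<close>)
  and true at time \<open>l\<close> (as it is at time \<open>0\<close>), but \<open>P\<close> switches only from true to false before \<open>T\<close>.\<close>

lemma least_period:
  fixes f :: "'s \<Rightarrow> 's"
  assumes A: "runs f P p x y" and B: "runs f (\<lambda>z. \<not> P z) q y x" and "p > 0" "q > 0"
    and l: "(f ^^ l) x = x" "0 < l"
  shows "p + q \<le> l"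
proof (rule ccontr)
  assume "\<not> p + q \<le> l"
  then have less: "l < p + q" by simp
  have per: "(f ^^ (p + q)) x = x"
    using A B by (simp add: runs_def add.commute[of p q] funpow_add)
  have late: "\<not> P ((f ^^ j) x)" if "p \<le> j" "j < p + q" for j
  proof -
    have "(f ^^ j) x = (f ^^ (j - p)) y"
      using A that funpow_add[of "j - p" p f] by (simp add: runs_def)
    then show ?thesis using B that by (simp add: runs_def)
  qed
  have "(f ^^ (l - 1)) x = (f ^^ (l - 1)) ((f ^^ (p + q)) x)"
    using per by simp
  also have "\<dots> = (f ^^ (p + q - 1)) ((f ^^ l) x)"
  proof -
    have "l - 1 + (p + q) = p + q - 1 + l" using l assms(3) by simp
    then have "f ^^ (l - 1) \<circ> f ^^ (p + q) = f ^^ (p + q - 1) \<circ> f ^^ l"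
      by (simp only: flip: funpow_add)
    then show ?thesis by (rule o_eq_dest)
  qed
  also have "\<dots> = (f ^^ (p + q - 1)) x" using l by simp
  finally have "\<not> P ((f ^^ (l - 1)) x)"
    using late[of "p + q - 1"] assms(3,4) by simp
  moreover have "P ((f ^^ j) x)" if "j < p" for j using A that by (simp add: runs_def)
  ultimately have "p \<le> l - 1" by (meson not_le)
  then have "\<not> P ((f ^^ l) x)" using late[of l] less by simp
  moreover have "P x" using A \<open>p > 0\<close> by (auto simp: runs_def)
  ultimately show False using l by simp
qed

section \<open>Words as letters interleaved with gaps\<close>

text \<open>Only used if there is one letter more than there are gaps, so that the word ends with a letter.\<close>

fun weave :: "'a list \<Rightarrow> 'a list list \<Rightarrow> 'a list" where
  "weave (x # xs) (G # Gs) = x # G @ weave xs Gs"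
| "weave xs Gs = xs"

lemma weave_snoc:
  "length xs = Suc (length Gs) \<Longrightarrow> weave (xs @ [x]) (Gs @ [G]) = weave xs Gs @ G @ [x]"
  by (induction xs Gs rule: weave.induct) (auto simp: length_Suc_conv)

lemma mset_weave:
  "length xs = Suc (length Gs) \<Longrightarrow> mset (weave xs Gs) = mset xs + mset (concat Gs)"
  by (induction xs Gs rule: weave.induct) auto

lemma weave_eq_Cons:
  "length xs = Suc (length Gs) \<Longrightarrow> \<exists>zs. weave xs Gs = hd xs # zs"
  by (cases xs; cases Gs) auto

lemma rotate_eq_Cons:
  assumes "xs \<noteq> []"
  obtains ys where "rotate k xs = xs ! (k mod length xs) # ys"
proof
  show "rotate k xs = xs ! (k mod length xs) # tl (rotate k xs)"
    using assms by (simp flip: hd_rotate_conv_nth)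
qed

text \<open>Built from the right: a letter of \<open>B\<close> put in front extends
  \<open>C\<close>, any other letter becomes the first woven one and turns \<open>C\<close> into the
  first gap.\<close>

lemma weave_decomposition:
  assumes "set M \<subseteq> A \<union> B" "\<not> set M \<subseteq> B"
  obtains C xs Gs D where "M = C @ weave xs Gs @ D" "length xs = Suc (length Gs)"
    "set xs \<subseteq> A" "set (concat Gs) \<subseteq> B" "set C \<subseteq> B" "set D \<subseteq> B"
proof -
  have "\<exists>C xs Gs D. M = C @ weave xs Gs @ D \<and> length xs = Suc (length Gs) \<and>
    set xs \<subseteq> A \<and> set (concat Gs) \<subseteq> B \<and> set C \<subseteq> B \<and> set D \<subseteq> B"
    using assms
  proof (induction M)
    case (Cons x M)
    show ?case
    proof (cases "set M \<subseteq> B")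
      case True
      then show ?thesis using Cons.prems
        by (intro exI[of _ "[]"] exI[of _ "[x]"] exI[of _ M]) auto
    next
      case False
      with Cons obtain C xs Gs D where *: "M = C @ weave xs Gs @ D" "length xs = Suc (length Gs)"
        "set xs \<subseteq> A" "set (concat Gs) \<subseteq> B" "set C \<subseteq> B" "set D \<subseteq> B"
        by auto
      show ?thesis
      proof (cases "x \<in> B")
        case True
        with * show ?thesis
          by (intro exI[of _ "x # C"] exI[of _ xs] exI[of _ Gs] exI[of _ D]) auto
      next
        case False
        with * Cons.prems show ?thesis
          by (intro exI[of _ "[]"] exI[of _ "x # xs"] exI[of _ "C # Gs"] exI[of _ D]) auto
      qed
    qed
  qed simp
  with that show ?thesis by blast
qed

lemma sum_mod_periodic:
  fixes g :: "nat \<Rightarrow> nat"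
  shows "(\<Sum>j<n * m. g (j mod m)) = n * (\<Sum>j<m. g j)"
proof -
  have "(\<Sum>j<n * m. g (j mod m)) = (\<Sum>i<n. \<Sum>j = i * m..<i * m + m. g (j mod m))"
    by (simp add: sum.nat_group)
  also have "\<dots> = (\<Sum>i<n. \<Sum>j<m. g j)"
    by (simp add: sum.atLeastLessThan_shift_0[of _ "_ * m"] lessThan_atLeast0)
  finally show ?thesis by simp
qed

section \<open>Two cliques joined by a bridge\<close>

text \<open>Loops are admitted here; they are harmless since the words have distinct letters.\<close>

definition bridged :: "'a set \<Rightarrow> 'a set \<Rightarrow> 'a \<Rightarrow> 'a \<Rightarrow> 'a \<Rightarrow> 'a \<Rightarrow> bool" where
  "bridged A B a b x y \<longleftrightarrow>
     x \<in> A \<and> y \<in> A \<or> x \<in> B \<and> y \<in> B \<or> x = a \<and> y = b \<or> x = b \<and> y = a"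

lemma bridged_swap: "bridged A B a b = bridged B A b a"
  by (auto simp: bridged_def fun_eq_iff)

lemma symp_bridged: "symp (bridged A B a b)"
  by (auto simp: bridged_def symp_def)

locale bridged_cliques =
  fixes A B :: "'a set" and a b :: 'a
  assumes finite: "finite A" "finite B" and disjoint: "A \<inter> B = {}" and a: "a \<in> A" and b: "b \<in> B"
begin

lemma swapped: "bridged_cliques B A b a"
  using finite disjoint a b by unfold_locales auto

abbreviation move :: "'a list \<Rightarrow> 'a list" where
  "move \<equiv> advance (bridged A B a b)"

abbreviation run :: "nat \<Rightarrow> 'a list \<Rightarrow> 'a list \<Rightarrow> bool" where
  "run \<equiv> runs move (\<lambda>xs. hd xs \<in> A)"

definition word :: "'a list \<Rightarrow> bool" where
  "word xs \<longleftrightarrow> distinct xs \<and> set xs = A \<union> B"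

section \<open>Runs with the head in one clique\<close>

lemma run_pass: "x \<in> A \<Longrightarrow> bridged A B a b x y \<Longrightarrow> run 1 (x # y # zs) (y # zs @ [x])"
  by (rule runs_1) auto

text \<open>Between the cliques only \<open>a\<close> and \<open>b\<close> are adjacent, so the head
  jumps over the letters of \<open>G\<close> one by one and sends them to the end.\<close>

lemma run_skip:
  assumes "x \<in> A" "set G \<subseteq> B" "\<not> (x = a \<and> b \<in> set G)"
  shows "run (length G) (x # G @ zs) (x # zs @ G)"
  using assms
proof (induction G arbitrary: zs)
  case (Cons y G)
  have "\<not> bridged A B a b x y"
    using Cons.prems disjoint a b by (auto simp: bridged_def)
  then have "run 1 (x # (y # G) @ zs) (x # G @ zs @ [y])"
    using Cons.prems by (intro runs_1) auto
  moreover have "run (length G) (x # G @ zs @ [y]) (x # (zs @ [y]) @ G)"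
    using Cons.prems by (intro Cons.IH) auto
  ultimately show ?case
    using runs_trans[of move _ 1] by fastforce
qed simp

lemma run_skip_pass:
  assumes "x \<in> A" "y \<in> A" "set G \<subseteq> B" "\<not> (x = a \<and> b \<in> set G)"
  shows "run (length G + 1) (x # G @ y # zs) (y # zs @ G @ [x])"
proof -
  have "run 1 (x # (y # zs) @ G) (y # zs @ G @ [x])"
    using run_pass[of x y "zs @ G"] assms by (simp add: bridged_def)
  moreover have "run (length G) (x # G @ y # zs) (x # (y # zs) @ G)"
    using assms by (intro run_skip) auto
  ultimately show ?thesis
    by (rule runs_trans[rotated])
qed

text \<open>\<open>a\<close> jumps over \<open>C\<close> and is stopped by \<open>b\<close>, to
  which the bridge passes the head. Only so does the head leave \<open>A\<close>.\<close>

lemma run_bump: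
  assumes "set C \<subseteq> B" "b \<notin> set C"
  shows "run (length C + 1) (a # C @ b # zs) (b # zs @ C @ [a])"
proof -
  have "run 1 (a # (b # zs) @ C) (b # zs @ C @ [a])"
    using run_pass[of a b "zs @ C"] a by (simp add: bridged_def)
  moreover have "run (length C) (a # C @ b # zs) (a # (b # zs) @ C)"
    using assms a by (intro run_skip) auto
  ultimately show ?thesis
    by (rule runs_trans[rotated])
qed

text \<open>Each round sends the head and the gap behind it to the end of the word, rotating letters
  and gaps by one place. By \<open>free\<close>, in none of these rounds does the head
  \<open>a\<close> face the gap containing \<open>b\<close>.\<close>

lemma run_weave:
  assumes len: "length xs = Suc (length Gs)" and ne: "Gs \<noteq> []"
    and sub: "set xs \<subseteq> A" "set (concat Gs) \<subseteq> B"
    and free: "\<And>j. j < k \<Longrightarrow>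
      \<not> (xs ! (j mod length xs) = a \<and> b \<in> set (Gs ! (j mod length Gs)))"
  shows "run (\<Sum>j<k. length (Gs ! (j mod length Gs)) + 1)
    (weave xs Gs) (weave (rotate k xs) (rotate k Gs))"
  using free
proof (induction k)
  case (Suc k)
  define x where "x = xs ! (k mod length xs)"
  define G where "G = Gs ! (k mod length Gs)"
  have "xs \<noteq> []" using len by auto
  with ne obtain ys Hs where x: "rotate k xs = x # ys" and G: "rotate k Gs = G # Hs"
    unfolding x_def G_def using rotate_eq_Cons by metis
  have len': "length ys = Suc (length Hs)"
    using arg_cong[OF x, of length] arg_cong[OF G, of length] len by simp
  have sub': "set (x # ys) \<subseteq> A" "set (concat (G # Hs)) \<subseteq> B"
    using sub unfolding x[symmetric] G[symmetric] set_concat set_rotate by auto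
  obtain zs where zs: "weave ys Hs = hd ys # zs"
    using weave_eq_Cons[OF len'] by blast
  have "hd ys \<in> A" using sub' len' by (cases ys) auto
  then have "run (length G + 1) (x # G @ hd ys # zs) (hd ys # zs @ G @ [x])"
    using sub' Suc.prems[of k] x_def G_def by (intro run_skip_pass) auto
  moreover have "hd ys # zs @ G @ [x] = weave (ys @ [x]) (Hs @ [G])"
    using zs weave_snoc[OF len'] by simp
  ultimately have "run (length G + 1) (weave (rotate k xs) (rotate k Gs))
      (weave (rotate (Suc k) xs) (rotate (Suc k) Gs))"
    using x G zs by (simp add: rotate_Suc)
  moreover have "run (\<Sum>j<k. length (Gs ! (j mod length Gs)) + 1)
      (weave xs Gs) (weave (rotate k xs) (rotate k Gs))"
    using Suc by simp
  ultimately show ?case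
    using runs_trans G_def by fastforce
qed simp

section \<open>A complete phase\<close>

lemma word_mset_cong: "mset xs = mset ys \<Longrightarrow> word xs \<longleftrightarrow> word ys"
  unfolding word_def using mset_eq_imp_distinct_iff mset_eq_setD by metis

text \<open>As \<open>A\<close> and \<open>B\<close> are disjoint, the two lists must list the
  cliques without repetition, which gives the counts needed for the step numbers.\<close>

lemma word_split:
  assumes "word xs" "mset xs = mset us + mset vs" "set us \<subseteq> A" "set vs \<subseteq> B"
  shows "distinct us" "set us = A" "length us = card A"
    "distinct vs" "set vs = B" "length vs = card B"
proof -
  have "word (us @ vs)"
    using assms(1,2) word_mset_cong[of xs "us @ vs"] by simp
  then show "distinct us" "set us = A" "distinct vs" "set vs = B"
    using assms(3,4) disjoint by (auto simp: word_def)
  then show "length us = card A" "length vs = card B"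
    using distinct_card[of us] distinct_card[of vs] by simp_all
qed

text \<open>Apart from the case of a single letter in \<open>A\<close>, there are three legs:
  \<open>a\<close> goes to the end, the weave is rotated until \<open>a\<close> faces the gap of
  \<open>b\<close> again, and \<open>a\<close> jumps over \<open>D\<close> to meet
  \<open>b\<close>.\<close>

lemma run_phase:
  assumes w: "word (a # M @ [b])"
  shows "run (card A * (card A + card B - 1)) (a # M @ [b]) (b # M @ [a])"
proof (cases "set M \<subseteq> B")
  case True
  have "length [a] = card A" "length (M @ [b]) = card B"
    using word_split[OF w, of "[a]" "M @ [b]"] True a b by simp_all
  then have "card A * (card A + card B - 1) = length M + 1" by simp
  moreover have "b \<notin> set M" using w by (simp add: word_def)
  ultimately show ?thesis
    using run_bump[OF True, of "[]"] by simp
next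
  case False
  have "set M \<subseteq> A \<union> B" using w by (auto simp: word_def)
  from weave_decomposition[OF this False] obtain C xs Gs D where
    M: "M = C @ weave xs Gs @ D" and len: "length xs = Suc (length Gs)" and
    sub: "set xs \<subseteq> A" "set (concat Gs) \<subseteq> B" "set C \<subseteq> B" "set D \<subseteq> B" .
  \<comment> \<open>\<open>a\<close> jumps over \<open>C\<close> and goes to the end; this brings
    \<open>D\<close>, \<open>b\<close> and \<open>C\<close> together as one gap.\<close>
  define G where "G = D @ b # C"
  define us where "us = xs @ [a]"
  define Hs where "Hs = Gs @ [G]"
  define m where "m = length Hs"
  have lens: "length us = Suc m" "length xs = m" "length Gs = m - 1" "m > 0"
    using len by (simp_all add: us_def Hs_def m_def)
  have subs: "set us \<subseteq> A" "set (concat Hs) \<subseteq> B"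
    using sub a b by (auto simp: us_def Hs_def G_def)
  have "mset (a # M @ [b]) = mset us + mset (concat Hs)"
    by (simp add: M us_def Hs_def G_def mset_weave[OF len])
  note split = word_split[OF w this subs]
  \<comment> \<open>After \<open>Suc m * m\<close> rounds letters and gaps are back in place;
    \<open>a\<close> meets the gap of \<open>b\<close> in the last of them, round \<open>k\<close>
    counted from 0.\<close>
  define k where "k = Suc m * m - 1"
  have kSuc: "Suc k = Suc m * m" using lens by (simp add: k_def)
  have k1: "k = (m - 1) * Suc m + m" and k2: "k = m * m + (m - 1)"
    using lens by (simp_all add: k_def algebra_simps diff_mult_distrib)
  have kmod: "k mod Suc m = m" "k mod m = m - 1"
    using lens by (subst k1, simp del: mult_Suc_right, subst k2, simp only: mod_mult_self3, simp)
  have rot: "rotate k us = a # xs" "rotate k Hs = G # Gs"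
  proof -
    have "rotate k us = rotate (length xs) us" "rotate k Hs = rotate (length Gs) Hs"
      using kmod lens by (simp_all add: rotate_conv_mod[of k] m_def)
    then show "rotate k us = a # xs" "rotate k Hs = G # Gs"
      by (simp_all add: us_def Hs_def rotate_append)
  qed
  have free: "\<not> (us ! (j mod length us) = a \<and> b \<in> set (Hs ! (j mod length Hs)))" if "j < k" for j
  proof
    assume *: "us ! (j mod length us) = a \<and> b \<in> set (Hs ! (j mod length Hs))"
    have "us ! m = a" using lens by (simp add: us_def nth_append)
    then have 1: "j mod Suc m = m"
      using * split(1) lens nth_eq_iff_index_eq[of us "j mod Suc m" m] by simp
    \<comment> \<open>Otherwise \<open>b\<close> would lie in one of the \<open>Gs\<close> and in
      \<open>G\<close>, contrary to distinctness.\<close>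
    have 2: "j mod m = m - 1"
    proof (rule ccontr)
      assume "j mod m \<noteq> m - 1"
      moreover have "j mod m < m" using lens by simp
      ultimately have "j mod m < length Gs" using lens by linarith
      then have "b \<in> set (concat Gs)"
        using * nth_mem[of "j mod m" Gs] by (auto simp: Hs_def m_def nth_append)
      then show False using split(4) by (auto simp: Hs_def G_def)
    qed
    \<comment> \<open>The meeting takes place only if \<open>Suc j\<close> is a multiple of the
      coprime numbers \<open>Suc m\<close> and \<open>m\<close>.\<close>
    have "Suc m dvd Suc j" using 1 mod_Suc[of j "Suc m"] by (simp add: mod_eq_0_iff_dvd)
    moreover have "m dvd Suc j" using 2 mod_Suc[of j m] lens by (simp add: mod_eq_0_iff_dvd)
    ultimately have "Suc m * m dvd Suc j" by (intro divides_mult) auto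
    then have "Suc m * m \<le> Suc j" by (rule dvd_imp_le) simp
    then show False using \<open>j < k\<close> kSuc by linarith
  qed
  obtain zs where zs: "weave xs Gs = hd xs # zs" using weave_eq_Cons[OF len] by blast
  have ab: "a \<noteq> b" "b \<notin> set C" "b \<notin> set D" using w by (auto simp: word_def M)
  have "hd xs \<in> A" using sub len by (cases xs) auto
  then have "run (length C + 1) (a # C @ hd xs # zs @ D @ [b]) (hd xs # (zs @ D @ [b]) @ C @ [a])"
    using ab a sub by (intro run_skip_pass) auto
  moreover have "hd xs # (zs @ D @ [b]) @ C @ [a] = weave us Hs"
    using zs by (simp add: us_def Hs_def G_def weave_snoc[OF len])
  ultimately have 1: "run (length C + 1) (a # M @ [b]) (weave us Hs)"
    by (simp add: M zs)
  define S where "S = (\<Sum>j<k. length (Hs ! (j mod length Hs)) + 1)"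
  have 2: "run S (weave us Hs) (weave (a # xs) (G # Gs))"
    unfolding S_def rot[symmetric] using lens subs free by (intro run_weave) (auto simp: m_def)
  have "run (length D + 1) (a # D @ b # C @ weave xs Gs) (b # (C @ weave xs Gs) @ D @ [a])"
    using ab sub by (intro run_bump) auto
  then have 3: "run (length D + 1) (weave (a # xs) (G # Gs)) (b # M @ [a])"
    by (simp add: M G_def)
  have "Hs ! (k mod m) = G"
    using kmod lens by (metis Hs_def nth_append_length)
  \<comment> \<open>The first and the last leg together take as many steps as the missing round
    \<open>k\<close>.\<close>
  then have "S + (length G + 1) = (\<Sum>j<Suc k. length (Hs ! (j mod m)) + 1)"
    by (simp add: S_def m_def)
  also have "\<dots> = Suc m * (\<Sum>j<m. length (Hs ! j) + 1)"
    unfolding kSuc by (rule sum_mod_periodic)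
  \<comment> \<open>One pass through the gaps crosses every letter of \<open>B\<close> once and has
    \<open>m\<close>, i.e. \<open>card A - 1\<close>, hand-overs.\<close>
  also have "(\<Sum>j<m. length (Hs ! j) + 1) = length (concat Hs) + m"
    by (simp add: sum_Suc length_concat sum_list_sum_nth m_def lessThan_atLeast0)
  also have "Suc m * (length (concat Hs) + m) = card A * (card A + card B - 1)"
    using split(3,6) lens(1) by simp
  finally have "length C + 1 + S + (length D + 1) = card A * (card A + card B - 1)"
    by (simp add: G_def)
  then show ?thesis
    using runs_trans[OF runs_trans[OF 1 2] 3] by simp
qed

section \<open>Reaching the start of a phase\<close>

text \<open>Unless \<open>a\<close> meets \<open>b\<close> at once, the Chinese remainder theorem
  for the number of letters and the number of gaps, which differ by one, yields a round in which
  \<open>a\<close> faces the gap of \<open>b\<close>.\<close>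

lemma reaches_phase_end:
  assumes w: "word L" and "hd L \<in> A"
  shows "\<exists>k M. (move ^^ k) L = b # M @ [a]"
proof -
  have bump: "\<exists>k M. run k (a # zs) (b # M @ [a])" if C: "zs = C @ ys" "set C \<subseteq> B" "b \<in> set C" for zs C ys
  proof -
    obtain D E where "C = D @ b # E" "b \<notin> set D" using split_list_first[OF C(3)] by blast
    then have "run (length D + 1) (a # zs) (b # (E @ ys @ D) @ [a])"
      using run_bump[of D "E @ ys"] C by simp
    then show ?thesis by (intro exI)
  qed
  obtain x M where L: "L = x # M" and x: "x \<in> A"
    using assms a by (cases L) (auto simp: word_def)
  have "\<exists>k M. run k L (b # M @ [a])"
  proof (cases "set M \<subseteq> B")
    case True
    then have "set [x] = A" "set M = B"
      using word_split[OF w, of "[x]" M] x L by simp_all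
    then show ?thesis using bump[of M M "[]"] L a b by auto
  next
    case False
    have "set M \<subseteq> A \<union> B" using w by (auto simp: word_def L)
    from weave_decomposition[OF this False] obtain C xs Gs D where
      M: "M = C @ weave xs Gs @ D" and len: "length xs = Suc (length Gs)" and
      sub: "set xs \<subseteq> A" "set (concat Gs) \<subseteq> B" "set C \<subseteq> B" "set D \<subseteq> B" .
    show ?thesis
    proof (cases "x = a \<and> b \<in> set C")
      case True
      then show ?thesis using bump[of M C] sub M L by auto
    next
      case nb: False
      define us where "us = xs @ [x]"
      define Hs where "Hs = Gs @ [D @ C]"
      define m where "m = length Hs"
      have lens: "length us = Suc m" "m > 0"
        using len by (simp_all add: us_def Hs_def m_def)
      have subs: "set us \<subseteq> A" "set (concat Hs) \<subseteq> B"
        using sub x by (auto simp: us_def Hs_def)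
      have "mset L = mset us + mset (concat Hs)"
        by (simp add: L M us_def Hs_def mset_weave[OF len])
      note split = word_split[OF w this subs]
      obtain i where i: "i < Suc m" "us ! i = a"
        using a lens unfolding split(2)[symmetric] by (auto simp: in_set_conv_nth)
      obtain l where l: "l < m" "b \<in> set (Hs ! l)"
        using b unfolding split(5)[symmetric] set_concat m_def by (metis UN_E in_set_conv_nth)
      define Q where "Q = (\<lambda>k. us ! (k mod length us) = a \<and> b \<in> set (Hs ! (k mod length Hs)))"
      obtain k0 where "[k0 = i] (mod Suc m)" "[k0 = l] (mod m)"
        using binary_chinese_remainder_nat[of "Suc m" m i l] by auto
      then have "Q k0"
        using i l lens by (simp add: Q_def cong_def m_def)
      \<comment> \<open>The first such round, so that \<open>run_weave\<close> applies to all rounds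
        before it.\<close>
      define k where "k = (LEAST k. Q k)"
      have k: "Q k" and least: "\<And>j. j < k \<Longrightarrow> \<not> Q j"
        unfolding k_def by (fact LeastI[of Q, OF \<open>Q k0\<close>]) (fact not_less_Least)
      obtain zs where zs: "weave xs Gs = hd xs # zs" using weave_eq_Cons[OF len] by blast
      have "hd xs \<in> A" using sub len by (cases xs) auto
      then have "run (length C + 1) (x # C @ hd xs # zs @ D) (hd xs # (zs @ D) @ C @ [x])"
        using nb x sub by (intro run_skip_pass) auto
      then have 1: "run (length C + 1) L (weave us Hs)"
        using zs by (simp add: L M us_def Hs_def weave_snoc[OF len])
      have 2: "run (\<Sum>j<k. length (Hs ! (j mod length Hs)) + 1)
          (weave us Hs) (weave (rotate k us) (rotate k Hs))"
        using lens subs least by (intro run_weave) (auto simp: m_def Q_def)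
      have "us \<noteq> []" "Hs \<noteq> []" by (simp_all add: us_def Hs_def)
      then obtain ys Fs where rot: "rotate k us = us ! (k mod length us) # ys"
          "rotate k Hs = Hs ! (k mod length Hs) # Fs"
        using rotate_eq_Cons by metis
      define G where "G = Hs ! (k mod length Hs)"
      have ys: "rotate k us = a # ys" and G: "rotate k Hs = G # Fs" "b \<in> set G"
        using rot k unfolding Q_def G_def by simp_all
      have "set G \<subseteq> B"
        using subs G(1) set_rotate[of k Hs] by auto
      then obtain n N where "run n (weave (rotate k us) (rotate k Hs)) (b # N @ [a])"
        using bump[of "G @ weave ys Fs" G "weave ys Fs"] G ys by auto
      from runs_trans[OF runs_trans[OF 1 2] this] show ?thesis by (intro exI)
    qed
  qed
  then obtain k M where "run k L (b # M @ [a])" by (elim exE)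
  from runs_funpow[OF this] show ?thesis by (intro exI)
qed

lemma mset_funpow_move [simp]: "mset ((move ^^ k) L) = mset L"
  by (induction k) auto

text \<open>By symmetry of the two cliques; a head in \<open>B\<close> is not in
  \<open>A\<close>.\<close>

lemma run_other_phase:
  assumes "word (b # M @ [a])"
  shows "runs move (\<lambda>xs. hd xs \<notin> A) (card B * (card A + card B - 1)) (b # M @ [a]) (a # M @ [b])"
proof -
  have "bridged_cliques.word B A (b # M @ [a])"
    using assms by (auto simp: word_def bridged_cliques.word_def[OF swapped])
  from bridged_cliques.run_phase[OF swapped this] show ?thesis
    using disjoint by (auto simp: bridged_swap[of B A] add.commute intro: runs_mono)
qed

text \<open>From a head in \<open>A\<close>, the end of this phase is reached first and then the
  whole phase of \<open>B\<close> follows; from a head in \<open>B\<close>, the end of its phase is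
  already the claim.\<close>

lemma reaches_phase_start:
  assumes w: "word L"
  shows "\<exists>k M. (move ^^ k) L = a # M @ [b]"
proof (cases "hd L \<in> A")
  case True
  then obtain k M where k: "(move ^^ k) L = b # M @ [a]"
    using reaches_phase_end[OF w] by blast
  then have "word (b # M @ [a])"
    using w word_mset_cong[OF mset_funpow_move, of k L] by simp
  then have "(move ^^ (card B * (card A + card B - 1))) ((move ^^ k) L) = a # M @ [b]"
    unfolding k by (intro runs_funpow[OF run_other_phase])
  then show ?thesis by (auto simp: funpow_funpow)
next
  case False
  then have "hd L \<in> B"
    using w a by (cases L) (auto simp: word_def)
  moreover have "bridged_cliques.word B A L"
    using w by (auto simp: word_def bridged_cliques.word_def[OF swapped])
  ultimately show ?thesis
    using bridged_cliques.reaches_phase_end[OF swapped] by (simp add: bridged_swap[of B A])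
qed

section \<open>The least period of a word\<close>

text \<open>Both claims hold at the phase start that \<open>L\<close> reaches after \<open>k\<close>
  steps. Powers of \<open>move\<close> commute, and injectivity cancels these \<open>k\<close>
  steps.\<close>

lemma move_period:
  assumes w: "word L"
  defines "N \<equiv> card A + card B"
  shows "(move ^^ (N * (N - 1))) L = L"
    and "(move ^^ l) L = L \<Longrightarrow> 0 < l \<Longrightarrow> N * (N - 1) \<le> l"
proof -
  obtain k M where k: "(move ^^ k) L = a # M @ [b]"
    using reaches_phase_start[OF w] by blast
  then have w': "word (a # M @ [b])"
    using w word_mset_cong[OF mset_funpow_move, of k L] by simp
  then have "word (b # M @ [a])" by (auto simp: word_def)
  note runs = run_phase[OF w'] run_other_phase[OF this]
  have N: "N * (N - 1) = card A * (card A + card B - 1) + card B * (card A + card B - 1)"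
    by (simp add: N_def add_mult_distrib)
  have pos: "card A > 0" "card B > 0" using a b finite card_gt_0_iff by blast+
  have swap: "(move ^^ k) ((move ^^ j) L) = (move ^^ j) ((move ^^ k) L)" for j
    by (simp add: funpow_funpow add.commute)
  have "(move ^^ (N * (N - 1))) (a # M @ [b]) = a # M @ [b]"
    unfolding N add.commute[of "card A * _"] funpow_add
    using runs_funpow[OF runs(1)] runs_funpow[OF runs(2)] by simp
  then have "(move ^^ k) ((move ^^ (N * (N - 1))) L) = (move ^^ k) L"
    by (simp add: swap k)
  moreover have "inj (move ^^ k)"
    using inj_advance[OF symp_bridged] by (rule inj_fn)
  ultimately show "(move ^^ (N * (N - 1))) L = L" by (simp add: inj_eq)
  show "N * (N - 1) \<le> l" if "(move ^^ l) L = L" "0 < l"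
  proof -
    have "(move ^^ l) (a # M @ [b]) = a # M @ [b]"
      using swap[of l] that k by simp
    from least_period[OF runs _ _ this that(2)] pos show ?thesis unfolding N by simp
  qed
qed

end

section \<open>States read as cyclic words\<close>

text \<open>\<open>i - 1\<close> and the final \<open>+ 1\<close> translate between labels, which
  start at 1, and residues, which start at 0.\<close>

definition reading :: "'a pair_pre_digraph \<Rightarrow> ('a \<Rightarrow> nat) \<times> nat \<Rightarrow> 'a list" where
  "reading G = (\<lambda>(\<sigma>, i).
     map (\<lambda>k. inv_into (pverts G) \<sigma> ((i - 1 + k) mod card (pverts G) + 1)) [0..<card (pverts G)])"

context
  fixes G :: "'a pair_pre_digraph" and V :: "'a set" and N :: nat
  defines "V \<equiv> pverts G" and "N \<equiv> card (pverts G)"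
  assumes two_verts: "N \<ge> 2"
begin

lemma bij_labeling: "\<sigma> \<in> labelings G \<Longrightarrow> bij_betw \<sigma> V {1..N}"
  by (simp add: labelings_def V_def N_def)

lemma bij_rotation: "bij_betw (\<lambda>k. (m + k) mod N + 1) {0..<N} {1..N}"
proof -
  have "inj_on (\<lambda>k. (m + k) mod N + 1) {0..<N}"
    by (rule inj_onI) (metis add_right_cancel atLeastLessThan_iff cong_add_lcancel_nat cong_def
        cong_less_modulus_unique_nat)
  moreover have "(\<lambda>k. (m + k) mod N + 1) ` {0..<N} \<subseteq> {1..N}"
    using two_verts by (auto simp: Suc_le_eq)
  ultimately show ?thesis
    by (simp add: bij_betw_def card_image card_subset_eq)
qed

lemma cyc_suc_in: "cyc_suc N i \<in> {1..N}"
  using two_verts by (auto simp: cyc_suc_def Suc_le_eq)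

lemma funpow_cyc_suc: "i \<in> {1..N} \<Longrightarrow> (cyc_suc N ^^ l) i = (i - 1 + l) mod N + 1"
proof (induction l)
  case (Suc l)
  then show ?case by (simp add: cyc_suc_def mod_Suc_eq)
qed auto

lemma compose_labeling:
  assumes \<sigma>: "\<sigma> \<in> labelings G" and i: "i \<in> {1..N}" "j \<in> {1..N}"
  shows "compose V (transpose i j) \<sigma> \<in> labelings G"
    and "m \<in> {1..N} \<Longrightarrow>
      inv_into V (compose V (transpose i j) \<sigma>) m = inv_into V \<sigma> (transpose i j m)"
proof -
  have t: "bij_betw (transpose i j) {1..N} {1..N}"
    using i by simp
  have "bij_betw (compose V (transpose i j) \<sigma>) V {1..N}"
    using bij_betw_compose[OF bij_labeling[OF \<sigma>] t] .
  then show "compose V (transpose i j) \<sigma> \<in> labelings G"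
    by (simp add: labelings_def V_def N_def)
  assume m: "m \<in> {1..N}"
  have tm: "transpose i j m \<in> {1..N}"
    using t m bij_betwE by blast
  have "inv_into V \<sigma> (transpose i j m) \<in> V"
    using bij_betw_inv_into[OF bij_labeling[OF \<sigma>]] tm bij_betwE by blast
  moreover have "compose V (transpose i j) \<sigma> (inv_into V \<sigma> (transpose i j m)) = m"
    using calculation tm bij_betw_inv_into_right[OF bij_labeling[OF \<sigma>]] by (simp add: compose_def)
  ultimately show "inv_into V (compose V (transpose i j) \<sigma>) m = inv_into V \<sigma> (transpose i j m)"
    using \<open>bij_betw (compose V (transpose i j) \<sigma>) V {1..N}\<close> bij_betw_inv_into_left by fastforce
qed

lemma TPro_eq:
  "TPro G (\<sigma>, i) =
     (if (inv_into V \<sigma> i, inv_into V \<sigma> (cyc_suc N i)) \<in> parcs G then \<sigma>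
      else compose V (transpose i (cyc_suc N i)) \<sigma>, cyc_suc N i)"
  by (simp add: TPro_def Let_def V_def N_def)

lemma TPro_states:
  assumes "s \<in> states G"
  shows "TPro G s \<in> states G" and "snd (TPro G s) = cyc_suc N (snd s)"
proof -
  obtain \<sigma> i where s: "s = (\<sigma>, i)" by fastforce
  have \<sigma>: "\<sigma> \<in> labelings G" and i: "i \<in> {1..N}"
    using assms s by (simp_all add: states_def N_def)
  have "states G = labelings G \<times> {1..N}" by (simp add: states_def N_def)
  then show "TPro G s \<in> states G" "snd (TPro G s) = cyc_suc N (snd s)"
    using \<sigma> compose_labeling(1)[OF \<sigma> i cyc_suc_in] cyc_suc_in by (simp_all add: s TPro_eq)
qed

lemma funpow_TPro_states:
  assumes "s \<in> states G"
  shows "(TPro G ^^ l) s \<in> states G" and "snd ((TPro G ^^ l) s) = (cyc_suc N ^^ l) (snd s)"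
  using assms TPro_states by (induction l) auto

lemma reading_bij:
  assumes "s \<in> states G"
  shows "distinct (reading G s)" and "set (reading G s) = V"
proof -
  obtain \<sigma> i where s: "s = (\<sigma>, i)" by fastforce
  have \<sigma>: "\<sigma> \<in> labelings G" using assms s by (simp add: states_def)
  have "bij_betw (inv_into V \<sigma> \<circ> (\<lambda>k. (i - 1 + k) mod N + 1)) {0..<N} V"
    using bij_rotation bij_betw_inv_into[OF bij_labeling[OF \<sigma>]] by (rule bij_betw_trans)
  then show "distinct (reading G s)" "set (reading G s) = V"
    by (auto simp: reading_def s V_def N_def bij_betw_def distinct_map comp_def)
qed

text \<open>The positions run through all labels, so for a known \<open>i\<close> the word
  determines the inverse of the labeling.\<close>

lemma inj_reading:
  assumes "(\<sigma>, i) \<in> states G" "(\<tau>, i) \<in> states G" and eq: "reading G (\<sigma>, i) = reading G (\<tau>, i)"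
  shows "\<sigma> = \<tau>"
proof -
  have \<sigma>: "\<sigma> \<in> labelings G" and \<tau>: "\<tau> \<in> labelings G"
    using assms by (simp_all add: states_def)
  have inv: "inv_into V \<sigma> m = inv_into V \<tau> m" if "m \<in> {1..N}" for m
  proof -
    have "m \<in> (\<lambda>k. (i - 1 + k) mod N + 1) ` {0..<N}"
      using that bij_betw_imp_surj_on[OF bij_rotation] by simp
    then obtain k where "k \<in> {0..<N}" "m = (i - 1 + k) mod N + 1" by (rule imageE)
    then show ?thesis
      using eq by (auto simp: reading_def V_def N_def)
  qed
  have "\<sigma> v = \<tau> v" if "v \<in> V" for v
  proof -
    have "\<sigma> v \<in> {1..N}" using bij_labeling[OF \<sigma>] that bij_betwE by blast
    then show ?thesis
      using inv[of "\<sigma> v"] that bij_betw_inv_into_left[OF bij_labeling[OF \<sigma>]]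
        bij_betw_inv_into_right[OF bij_labeling[OF \<tau>]] by metis
  qed
  then show ?thesis
    using \<sigma> \<tau> by (intro extensionalityI[of _ V]) (auto simp: labelings_def V_def)
qed

text \<open>Passing to the next \<open>i\<close> shifts all positions by one; a swap then merely
  exchanges the vertices at the first and last positions.\<close>

lemma reading_TPro:
  assumes "s \<in> states G"
  shows "reading G (TPro G s) = advance (\<lambda>x y. (x, y) \<in> parcs G) (reading G s)"
proof -
  obtain \<sigma> i where s: "s = (\<sigma>, i)" by fastforce
  have \<sigma>: "\<sigma> \<in> labelings G" and i: "i \<in> {1..N}"
    using assms s by (simp_all add: states_def N_def)
  define c where "c k = (i - 1 + k) mod N + 1" for k
  define \<rho> where "\<rho> = inv_into V \<sigma>"
  have c_in: "c k \<in> {1..N}" for k using two_verts by (auto simp: c_def Suc_le_eq)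
  have c0: "c 0 = i" and c1: "c 1 = cyc_suc N i"
    using i by (auto simp: c_def cyc_suc_def)
  have "c N = c 0" by (simp only: c_def mod_add_self2 add_0_right)
  then have cN: "c N = i" using c0 by simp
  have c_inj: "c k = c l \<longleftrightarrow> k = l" if "k < N" "l < N" for k l
  proof -
    have "inj_on c {0..<N}"
      unfolding c_def[abs_def] using bij_rotation by (rule bij_betw_imp_inj_on)
    then show ?thesis using that by (simp add: inj_on_eq_iff)
  qed
  have c_shift: "(c 1 - 1 + k) mod N + 1 = c (Suc k)" for k
    by (simp only: c_def add_diff_cancel_right' mod_add_left_eq) simp
  have upt: "[0..<N] = 0 # 1 # [2..<N]"
    using two_verts by (simp add: upt_conv_Cons numeral_2_eq_2)
  have "reading G s = map (\<lambda>k. \<rho> (c k)) [0..<N]"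
    by (simp add: reading_def s c_def \<rho>_def V_def N_def)
  then have old: "reading G s = \<rho> i # \<rho> (c 1) # map (\<lambda>k. \<rho> (c k)) [2..<N]"
    unfolding upt by (simp add: c0)
  have new: "reading G (\<sigma>', c 1) = map (\<lambda>k. inv_into V \<sigma>' (c (Suc k))) [0..<N]" for \<sigma>'
    unfolding reading_def N_def[symmetric] unfolding V_def[symmetric]
    by (simp only: prod.case c_shift)
  have Suc_N: "Suc (N - 1) = N" using two_verts by simp
  \<comment> \<open>The new word is cut at its two ends, the old one after two letters, so that the
    middle parts agree up to a shift.\<close>
  have upt': "[0..<N] = 0 # [1..<N - 1] @ [N - 1]"
    using two_verts upt_Suc_append[of 0 "N - 1"] by (simp add: upt_conv_Cons)
  have shift: "map f [2..<N] = map (\<lambda>k. f (Suc k)) [1..<N - 1]" for f :: "nat \<Rightarrow> 'a"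
    using two_verts map_Suc_upt[of 1 "N - 1"] by (simp add: numeral_2_eq_2 flip: map_map[unfolded comp_def])
  show ?thesis
  proof (cases "(\<rho> i, \<rho> (c 1)) \<in> parcs G")
    case True
    then have "TPro G s = (\<sigma>, c 1)"
      by (simp only: TPro_eq s \<rho>_def c1 if_True)
    then have "reading G (TPro G s) = map (\<lambda>k. \<rho> (c (Suc k))) [0..<N]"
      by (simp only: new \<rho>_def)
    then show ?thesis
      using True cN Suc_N unfolding old upt' shift by simp
  next
    case False
    define \<tau> where "\<tau> = compose V (transpose i (c 1)) \<sigma>"
    from False have "TPro G s = (\<tau>, c 1)"
      by (simp only: TPro_eq s \<rho>_def c1 \<tau>_def if_False)
    then have "reading G (TPro G s) = map (\<lambda>k. \<rho> (transpose i (c 1) (c (Suc k)))) [0..<N]"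
      by (simp only: new \<tau>_def \<rho>_def compose_labeling(2)[OF \<sigma> i c_in c_in])
    also have "\<dots> = \<rho> i # map (\<lambda>k. \<rho> (c (Suc k))) [1..<N - 1] @ [\<rho> (c 1)]"
    proof -
      have "transpose i (c 1) (c (Suc k)) = c (Suc k)" if "k \<in> {1..<N - 1}" for k
      proof -
        have "Suc k < N" "1 < N" "0 < N" "k \<noteq> 0" using that by auto
        then have "c (Suc k) \<noteq> c 0" "c (Suc k) \<noteq> c 1"
          using c_inj[of "Suc k" 0] c_inj[of "Suc k" 1] by simp_all
        then show ?thesis by (simp add: c0)
      qed
      then show ?thesis
        unfolding upt' using Suc_N cN by simp
    qed
    finally show ?thesis
      using False unfolding old shift by simp
  qed
qed

lemma reading_funpow_TPro:
  assumes "s \<in> states G"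
    and adj: "\<And>x y. x \<in> V \<Longrightarrow> y \<in> V \<Longrightarrow> x \<noteq> y \<Longrightarrow> (x, y) \<in> parcs G \<longleftrightarrow> E x y"
  shows "reading G ((TPro G ^^ l) s) = (advance E ^^ l) (reading G s)"
proof (induction l)
  case (Suc l)
  let ?s = "(TPro G ^^ l) s"
  have s: "?s \<in> states G" using funpow_TPro_states assms(1) by blast
  have "advance (\<lambda>x y. (x, y) \<in> parcs G) (reading G ?s) = advance E (reading G ?s)"
    using reading_bij[OF s] adj by (intro advance_cong) auto
  with Suc reading_TPro[OF s] show ?case by simp
qed simp

text \<open>The word determines the labeling only together with \<open>i\<close>, which advances by
  one in each step and returns if \<open>N\<close> divides \<open>l\<close>.\<close>

lemma funpow_TPro_eq_self:
  assumes "s \<in> states G" "N dvd l" "reading G ((TPro G ^^ l) s) = reading G s"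
  shows "(TPro G ^^ l) s = s"
proof -
  have i: "snd s \<in> {1..N}" using assms(1) by (auto simp: states_def N_def)
  have "(snd s - 1 + l) mod N = (snd s - 1) mod N" using assms(2) by (auto elim: dvdE)
  then have "snd ((TPro G ^^ l) s) = snd s"
    using funpow_TPro_states(2)[OF assms(1)] funpow_cyc_suc[OF i] i by auto
  then show ?thesis
    using inj_reading[of "fst ((TPro G ^^ l) s)" "snd s" "fst s"] assms(1,3)
      funpow_TPro_states(1)[OF assms(1), of l] by (metis prod.collapse)
qed

end

section \<open>Orbit lengths on the bridge sum\<close>

theorem theorem7:
  fixes K\<^sub>1 K\<^sub>2 :: "'a pair_pre_digraph" and v\<^sub>1 v\<^sub>2 :: 'a and n\<^sub>1 n\<^sub>2 :: nat
  assumes "n\<^sub>1 \<ge> 1" and "n\<^sub>2 \<ge> 1"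
    and "pair_graph K\<^sub>1" and "complete_digraph n\<^sub>1 (with_proj K\<^sub>1)"
    and "pair_graph K\<^sub>2" and "complete_digraph n\<^sub>2 (with_proj K\<^sub>2)"
    and "pverts K\<^sub>1 \<inter> pverts K\<^sub>2 = {}"
    and "v\<^sub>1 \<in> pverts K\<^sub>1" and "v\<^sub>2 \<in> pverts K\<^sub>2"
  shows "\<forall>s \<in> states (bridge_sum K\<^sub>1 K\<^sub>2 v\<^sub>1 v\<^sub>2).
    orbit_length (TPro (bridge_sum K\<^sub>1 K\<^sub>2 v\<^sub>1 v\<^sub>2)) s = (n\<^sub>1 + n\<^sub>2) * (n\<^sub>1 + n\<^sub>2 - 1)"
proof
  let ?A = "pverts K\<^sub>1" and ?B = "pverts K\<^sub>2" and ?G = "bridge_sum K\<^sub>1 K\<^sub>2 v\<^sub>1 v\<^sub>2"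
  let ?E = "bridged ?A ?B v\<^sub>1 v\<^sub>2"
  fix s assume s: "s \<in> states ?G"
  have K1: "finite ?A" "card ?A = n\<^sub>1" "parcs K\<^sub>1 = {(u, v). (u, v) \<in> ?A \<times> ?A \<and> u \<noteq> v}"
    using assms(4) by (simp_all add: complete_digraph_pair_def)
  have K2: "finite ?B" "card ?B = n\<^sub>2" "parcs K\<^sub>2 = {(u, v). (u, v) \<in> ?B \<times> ?B \<and> u \<noteq> v}"
    using assms(6) by (simp_all add: complete_digraph_pair_def)
  interpret bridged_cliques ?A ?B v\<^sub>1 v\<^sub>2
    using K1(1) K2(1) assms(7-9) by unfold_locales
  have V: "pverts ?G = ?A \<union> ?B" by (simp add: bridge_sum_def)
  have N: "card (pverts ?G) = n\<^sub>1 + n\<^sub>2"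
    unfolding V using card_Un_disjoint[OF finite disjoint] K1 K2 by simp
  have two: "card (pverts ?G) \<ge> 2" using N assms(1,2) by simp
  have "(x, y) \<in> parcs ?G \<longleftrightarrow> ?E x y" if "x \<noteq> y" for x y
    using that K1(3) K2(3) by (auto simp: bridge_sum_def bridged_def)
  then have reading: "reading ?G ((TPro ?G ^^ l) s) = (advance ?E ^^ l) (reading ?G s)" for l
    using reading_funpow_TPro[OF two s] by blast
  have "word (reading ?G s)"
    using reading_bij[OF two s] by (simp add: word_def V)
  note period = move_period[OF this, unfolded K1(2) K2(2)]
  let ?T = "(n\<^sub>1 + n\<^sub>2) * (n\<^sub>1 + n\<^sub>2 - 1)"
  show "orbit_length (TPro ?G) s = ?T"
    unfolding orbit_length_def
  proof (rule Least_equality)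
    \<comment> \<open>\<open>?T\<close> is a multiple of the number of vertices, so \<open>i\<close>
      returns together with the word.\<close>
    have "(TPro ?G ^^ ?T) s = s"
      using period(1) by (intro funpow_TPro_eq_self[OF two s]) (simp_all add: reading N)
    then show "1 \<le> ?T \<and> (TPro ?G ^^ ?T) s = s"
      using assms(1,2) by simp
  next
    fix l assume l: "1 \<le> l \<and> (TPro ?G ^^ l) s = s"
    then have "(advance ?E ^^ l) (reading ?G s) = reading ?G s"
      using reading[of l] by simp
    then show "?T \<le> l" using period(2)[of l] l by simp
  qed
qed

end
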